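(* Let $(X,T)$ be a transitive topological dynamical system that is disjoint from all minimal systems. Then for every $n\in\mathbb{N}$ the system $(X,T^n)$ is also disjoint from all minimal systems.
   Context: A topological dynamical system (t.d.s.) is a pair $(X,T)$ where $X$ is a compact metric space and $T:X\to X$ is continuous and surjective. $\mathbb{Z}_+$ is the set of nonnegative integers and $\mathbb{N}$ the set of positive integers. $T^n$ is the $n$-fold composition of $T$ with itself. $(X,T)$ is transitive if for all nonempty open $U,V\subset X$ the set $\{n\in\mathbb{Z}_+:U\cap T^{-n}V\neq\emptyset\}$ is infinite; it is minimal (a minimal system) if for every $x\in X$ the orbit $\{T^nx:n\in\mathbb{Z}_+\}$ is dense. A joining of t.d.s. $(X,T)$ and $(Y,S)$ is a nonempty closed set $J\subset X\times Y$ with $(T\times S)(J)\subseteq J$ which projects onto $X$ and onto $Y$ under the coordinate projections; $(X,T)$ and $(Y,S)$ are disjoint if $X\times Y$ is their only joining. *)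

theory Defs
  imports "HOL-Analysis.Analysis"
begin

text \<open>
  A system consists of an abstract metric space \<open>X\<close> (a carrier \<open>mspace X\<close> inside a type) and a
  total function whose values outside the carrier are irrelevant. Spaces are nonempty: joinings
  are required to be nonempty, so \<open>X \<times> Y\<close> is a joining only if both factors are nonempty.
\<close>

definition tds :: "'a metric \<Rightarrow> ('a \<Rightarrow> 'a) \<Rightarrow> bool" where
  "tds X T \<longleftrightarrow>
     mspace X \<noteq> {} \<and>
     compact_space (mtopology_of X) \<and>
     continuous_map (mtopology_of X) (mtopology_of X) T \<and>
     T ` mspace X = mspace X"

definition transitive_system :: "'a metric \<Rightarrow> ('a \<Rightarrow> 'a) \<Rightarrow> bool" where
  "transitive_system X T \<longleftrightarrow>
     tds X T \<and>
     (\<forall>U V. openin (mtopology_of X) U \<and> U \<noteq> {} \<and> openin (mtopology_of X) V \<and> V \<noteq> {} \<longrightarrow>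
        infinite {n::nat. U \<inter> {x \<in> mspace X. (T ^^ n) x \<in> V} \<noteq> {}})"

definition minimal_system :: "'a metric \<Rightarrow> ('a \<Rightarrow> 'a) \<Rightarrow> bool" where
  "minimal_system X T \<longleftrightarrow>
     tds X T \<and>
     (\<forall>x \<in> mspace X. mtopology_of X closure_of (range (\<lambda>n::nat. (T ^^ n) x)) = mspace X)"

definition joining ::
  "'a metric \<Rightarrow> ('a \<Rightarrow> 'a) \<Rightarrow> 'b metric \<Rightarrow> ('b \<Rightarrow> 'b) \<Rightarrow> ('a \<times> 'b) set \<Rightarrow> bool" where
  "joining X T Y S J \<longleftrightarrow>
     J \<noteq> {} \<and>
     closedin (prod_topology (mtopology_of X) (mtopology_of Y)) J \<and>
     map_prod T S ` J \<subseteq> J \<and>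
     fst ` J = mspace X \<and>
     snd ` J = mspace Y"

definition disjoint_systems ::
  "'a metric \<Rightarrow> ('a \<Rightarrow> 'a) \<Rightarrow> 'b metric \<Rightarrow> ('b \<Rightarrow> 'b) \<Rightarrow> bool" where
  "disjoint_systems X T Y S \<longleftrightarrow> {J. joining X T Y S J} = {mspace X \<times> mspace Y}"

text \<open>
  HOL cannot quantify over types inside a formula, so the type \<open>'b\<close> carrying the minimal
  systems is a parameter. A compact metric space has at most the cardinality of the continuum, so
  it is isometric to a metric space whose carrier is a set of reals. Since disjointness is invariant
  under isomorphism of systems, \<open>TYPE(real)\<close> already covers all minimal systems.
\<close>

definition disjoint_from_all_minimal :: "'b itself \<Rightarrow> 'a metric \<Rightarrow> ('a \<Rightarrow> 'a) \<Rightarrow> bool" where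
  "disjoint_from_all_minimal _ X T \<longleftrightarrow>
     (\<forall>(Y :: 'b metric) S. minimal_system Y S \<longrightarrow> disjoint_systems X T Y S)"

end

theory Submission imports Defs begin

text \<open>
  Given a joining \<open>J\<close> of \<open>(X, T\<^sup>n)\<close> with a minimal system \<open>(Y, S)\<close>, let \<open>(Y', S')\<close> be the tower of height
  \<open>n\<close> over \<open>(Y, S)\<close>: its points are the pairs \<open>(y, i)\<close> with \<open>i < n\<close>, and \<open>S'\<close> moves up one floor, applying
  \<open>S\<close> on returning to the ground floor. The tower is minimal, and the points \<open>(T\<^sup>i x, (y, i))\<close> with
  \<open>(x, y) \<in> J\<close> form a joining of \<open>(X, T)\<close> with \<open>(Y', S')\<close>. By disjointness this joining is everything, and
  its ground floor is \<open>J\<close>.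
\<close>

section \<open>Iterates of a system and elementary facts about joinings\<close>

lemma tds_iterate_in: "tds X T \<Longrightarrow> x \<in> mspace X \<Longrightarrow> (T ^^ n) x \<in> mspace X"
  by (induction n) (auto simp: tds_def)

lemma tds_iterate_image: "tds X T \<Longrightarrow> (T ^^ n) ` mspace X = mspace X"
proof (induction n)
  case (Suc n)
  then show ?case by (metis funpow.simps(2) image_comp tds_def)
qed auto

lemma tds_iterate_continuous:
  "tds X T \<Longrightarrow> continuous_map (mtopology_of X) (mtopology_of X) (T ^^ n)"
proof (induction n)
  case 0
  then show ?case by (simp add: id_def[symmetric])
next
  case (Suc n)
  then show ?case unfolding funpow.simps by (metis continuous_map_compose tds_def)
qed

lemma tds_iterate: "tds X T \<Longrightarrow> tds X (T ^^ n)"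
  by (metis tds_def tds_iterate_continuous tds_iterate_image)

lemma joining_Times:
  assumes "tds X T" "tds Y S"
  shows "joining X T Y S (mspace X \<times> mspace Y)"
  using assms closedin_topspace[of "prod_topology (mtopology_of X) (mtopology_of Y)"]
  by (auto simp: joining_def tds_def fst_image_times snd_image_times)

text \<open>The full product is itself a joining, by nonemptiness of the carriers and invariance
  under both maps. So only the uniqueness half of disjointness is left to check.\<close>

lemma disjoint_systems_iff:
  assumes "tds X T" "tds Y S"
  shows "disjoint_systems X T Y S \<longleftrightarrow> (\<forall>J. joining X T Y S J \<longrightarrow> J = mspace X \<times> mspace Y)"
  using joining_Times[OF assms] unfolding disjoint_systems_def by auto

lemma disjoint_systemsD:
  "disjoint_systems X T Y S \<Longrightarrow> joining X T Y S J \<Longrightarrow> J = mspace X \<times> mspace Y"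
  by (metis disjoint_systems_def mem_Collect_eq singletonD)

lemma joining_subset: "joining X T Y S J \<Longrightarrow> J \<subseteq> mspace X \<times> mspace Y"
  unfolding joining_def by force

section \<open>Transport of systems, minimality and joinings along a homeomorphism\<close>

lemma homeomorphic_maps_mspace:
  assumes "homeomorphic_maps (mtopology_of Y) (mtopology_of Z) e g"
  shows "e ` mspace Y = mspace Z" "g ` mspace Z = mspace Y" "\<And>y. y \<in> mspace Y \<Longrightarrow> g (e y) = y"
  using assms homeomorphic_maps_map[of "mtopology_of Y" "mtopology_of Z" e g]
    homeomorphic_imp_surjective_map[of "mtopology_of Y" "mtopology_of Z" e]
    homeomorphic_imp_surjective_map[of "mtopology_of Z" "mtopology_of Y" g]
  by simp_all

lemma conjugate_iterate:
  assumes "tds Y S" "\<And>y. y \<in> mspace Y \<Longrightarrow> g (e y) = y" "y \<in> mspace Y"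
  shows "((e \<circ> S \<circ> g) ^^ k) (e y) = e ((S ^^ k) y)"
  using assms by (induction k) (auto simp: tds_iterate_in)

lemma tds_conjugate:
  assumes "tds Y S" and h: "homeomorphic_maps (mtopology_of Y) (mtopology_of Z) e g"
  shows "tds Z (e \<circ> S \<circ> g)"
proof -
  have e: "e ` mspace Y = mspace Z" and g: "g ` mspace Z = mspace Y"
    using homeomorphic_maps_mspace[OF h] by simp_all
  have c: "continuous_map (mtopology_of Y) (mtopology_of Z) e"
    "continuous_map (mtopology_of Z) (mtopology_of Y) g"
    using h by (auto simp: homeomorphic_maps_def)
  have "compact_space (mtopology_of Z)"
    using assms(1) image_compactin[OF _ c(1), of "mspace Y"] e
    by (simp add: compact_space_def tds_def)
  moreover have "(e \<circ> S \<circ> g) ` mspace Z = mspace Z"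
    using assms(1) e g by (simp only: image_comp[symmetric] tds_def)
  ultimately show ?thesis
    using assms(1) e c unfolding tds_def by (auto intro!: continuous_map_compose)
qed

text \<open>A homeomorphism commutes with closure, and \<open>e\<close> carries the
  \<open>S\<close>-orbit of \<open>y\<close> onto the orbit of \<open>e y\<close> under the
  conjugate map. Every point of \<open>Z\<close> has the form \<open>e y\<close>.\<close>

lemma minimal_system_conjugate:
  assumes m: "minimal_system Y S" and h: "homeomorphic_maps (mtopology_of Y) (mtopology_of Z) e g"
  shows "minimal_system Z (e \<circ> S \<circ> g)"
proof -
  have t: "tds Y S" using m by (simp add: minimal_system_def)
  have e: "e ` mspace Y = mspace Z" and ge: "\<And>y. y \<in> mspace Y \<Longrightarrow> g (e y) = y"
    using homeomorphic_maps_mspace[OF h] by simp_all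
  have "mtopology_of Z closure_of (range (\<lambda>k. ((e \<circ> S \<circ> g) ^^ k) (e y))) = mspace Z"
    if y: "y \<in> mspace Y" for y
  proof -
    have "range (\<lambda>k. ((e \<circ> S \<circ> g) ^^ k) (e y)) = e ` range (\<lambda>k. (S ^^ k) y)"
      by (simp only: conjugate_iterate[where g = g, OF t ge y] image_image)
    moreover have "homeomorphic_map (mtopology_of Y) (mtopology_of Z) e"
      using h homeomorphic_maps_map by blast
    moreover have "range (\<lambda>k. (S ^^ k) y) \<subseteq> mspace Y"
      using tds_iterate_in[OF t y] by auto
    ultimately show ?thesis
      using m y e by (simp add: homeomorphic_map_closure_of minimal_system_def)
  qed
  then show ?thesis
    using tds_conjugate[OF t h] e unfolding minimal_system_def by (metis imageE)
qed

lemma joining_conjugate: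
  assumes t: "tds Y S" and h: "homeomorphic_maps (mtopology_of Y) (mtopology_of Z) e g"
    and J: "joining X T Y S J"
  shows "joining X T Z (e \<circ> S \<circ> g) (map_prod id e ` J)"
proof -
  have e: "e ` mspace Y = mspace Z" and ge: "\<And>y. y \<in> mspace Y \<Longrightarrow> g (e y) = y"
    using homeomorphic_maps_mspace[OF h] by simp_all
  have "homeomorphic_maps (prod_topology (mtopology_of X) (mtopology_of Y))
      (prod_topology (mtopology_of X) (mtopology_of Z)) (map_prod id e) (map_prod id g)"
    using h by (simp add: map_prod_def homeomorphic_maps_prod homeomorphic_maps_id[unfolded id_def])
  then have "homeomorphic_map (prod_topology (mtopology_of X) (mtopology_of Y))
      (prod_topology (mtopology_of X) (mtopology_of Z)) (map_prod id e)"
    using homeomorphic_maps_map by blast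
  then have "closedin (prod_topology (mtopology_of X) (mtopology_of Z)) (map_prod id e ` J)"
    using J homeomorphic_map_closedness_eq unfolding joining_def by blast
  moreover have "map_prod T (e \<circ> S \<circ> g) ` map_prod id e ` J \<subseteq> map_prod id e ` J"
  proof clarsimp
    fix x y assume xy: "(x, y) \<in> J"
    then have "(T x, S y) \<in> J" using J by (force simp: joining_def)
    moreover have "g (e y) = y" using xy joining_subset[OF J] ge by auto
    ultimately show "(T x, e (S (g (e y)))) \<in> map_prod id e ` J" by force
  qed
  moreover have "fst ` map_prod id e ` J = fst ` J" "snd ` map_prod id e ` J = e ` snd ` J"
    by (simp_all add: image_image)
  ultimately show ?thesis
    using J e by (simp add: joining_def)
qed

text \<open>A joining with \<open>Y\<close> is pushed forward to a joining with \<open>Z\<close>,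
  which must be the full product. Injectivity of \<open>e\<close> on the carrier of \<open>Y\<close>
  then pulls this back.\<close>

lemma disjoint_systems_conjugate:
  assumes "tds X T" "tds Y S" and h: "homeomorphic_maps (mtopology_of Y) (mtopology_of Z) e g"
    and d: "disjoint_systems X T Z (e \<circ> S \<circ> g)"
  shows "disjoint_systems X T Y S"
  unfolding disjoint_systems_iff[OF assms(1,2)]
proof (intro allI impI)
  fix J assume J: "joining X T Y S J"
  have e: "e ` mspace Y = mspace Z" and ge: "\<And>y. y \<in> mspace Y \<Longrightarrow> g (e y) = y"
    using homeomorphic_maps_mspace[OF h] by simp_all
  have im: "map_prod id e ` J = mspace X \<times> mspace Z"
    by (rule disjoint_systemsD[OF d joining_conjugate[OF assms(2) h J]])
  have "(x, y) \<in> J" if "x \<in> mspace X" "y \<in> mspace Y" for x y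
  proof -
    have "(x, e y) \<in> map_prod id e ` J" using im e that by auto
    then obtain y' where "(x, y') \<in> J" "e y' = e y" by auto
    then show ?thesis using ge that(2) joining_subset[OF J] by (metis mem_Sigma_iff subsetD)
  qed
  then show "J = mspace X \<times> mspace Y" using joining_subset[OF J] by auto
qed

section \<open>Copies of compact metric spaces on sets of reals\<close>

lemma compact_metric_lepoll_reals:
  assumes "compact_space (mtopology_of Y)"
  shows "mspace Y \<lesssim> (UNIV :: real set)"
proof -
  interpret Metric_space "mspace Y" "mdist Y" by simp
  have "mtotally_bounded (mspace Y)"
    using assms compact_space_eq_mcomplete_mtotally_bounded by (simp add: mtopology_of_def)
  then have "\<forall>k::nat. \<exists>K. finite K \<and> K \<subseteq> mspace Y \<and> mspace Y \<subseteq> (\<Union>x\<in>K. mball x (1 / Suc k))"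
    unfolding mtotally_bounded_def by (metis of_nat_0_less_iff zero_less_Suc zero_less_divide_1_iff)
  then obtain K where fin: "\<And>k::nat. finite (K k)"
    and cov: "\<And>k. mspace Y \<subseteq> (\<Union>x\<in>K k. mball x (1 / Suc k))" by metis
  \<comment> \<open>A point is coded by the set of all net balls that contain it. Centres are tagged
    with their scale \<open>k\<close>, as one point may be a centre at several scales; numbering the
    countable set \<open>?D\<close> turns the code into a set of naturals.\<close>
  let ?D = "\<Union>k. K k \<times> {k}"
  let ?f = "\<lambda>y. to_nat_on ?D ` {p \<in> ?D. y \<in> mball (fst p) (1 / Suc (snd p))}"
  have D: "countable ?D" using fin by (auto intro: countable_finite)
  have "inj_on ?f (mspace Y)"
  proof (rule inj_onI, rule ccontr)
    fix y z assume yz: "y \<in> mspace Y" "z \<in> mspace Y" "?f y = ?f z" "y \<noteq> z"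
    then have eq: "{p \<in> ?D. y \<in> mball (fst p) (1 / Suc (snd p))}
        = {p \<in> ?D. z \<in> mball (fst p) (1 / Suc (snd p))}"
      using inj_on_image_eq_iff[OF inj_on_to_nat_on[OF D]] by (metis (no_types, lifting) mem_Collect_eq subsetI)
    have "mdist Y y z / 2 > 0" using yz by simp
    \<comment> \<open>At this scale the diameter bound \<open>2 / Suc k\<close> is below the
      distance of \<open>y\<close> and \<open>z\<close>, so no ball of radius
      \<open>1 / Suc k\<close> contains both. Equal codes would put \<open>z\<close> into the net
      ball around \<open>y\<close>'s centre.\<close>
    then obtain k where k: "1 / Suc k < mdist Y y z / 2"
      using nat_approx_posE by blast
    obtain x where x: "x \<in> K k" "y \<in> mball x (1 / Suc k)" using cov yz(1) by blast
    then have "(x, k) \<in> {p \<in> ?D. y \<in> mball (fst p) (1 / Suc (snd p))}" by auto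
    then have "z \<in> mball x (1 / Suc k)" unfolding eq by simp
    then show False
      using x(2) k triangle''[of y x z] commute[of x y] commute[of x z] by (auto simp: triangle)
  qed
  then have "mspace Y \<lesssim> (UNIV :: nat set set)" by (auto simp: lepoll_def)
  then show ?thesis
    using nat_sets_eqpoll_reals eqpoll_imp_lepoll lepoll_trans by blast
qed

text \<open>The metric is carried over along any injection \<open>e\<close>, which thereby becomes
  an isometry onto its image. Only the cardinality of the target type matters, not a topology it may
  already have.\<close>

lemma homeomorphic_copy_of_metric:
  assumes "mspace Y \<lesssim> (UNIV :: 'c set)"
  obtains Z :: "'c metric" and e g where "homeomorphic_maps (mtopology_of Y) (mtopology_of Z) e g"
proof -
  obtain e :: "_ \<Rightarrow> 'c" where e: "inj_on e (mspace Y)" using assms by (auto simp: lepoll_def)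
  let ?g = "inv_into (mspace Y) e"
  let ?M = "e ` mspace Y" and ?d = "\<lambda>a b. mdist Y (?g a) (?g b)"
  interpret Y: Metric_space "mspace Y" "mdist Y" by simp
  interpret Z: Metric_space ?M ?d
  proof
    show "\<And>x y. x \<in> ?M \<Longrightarrow> y \<in> ?M \<Longrightarrow> (?d x y = 0) = (x = y)"
      using e by (auto simp: inv_into_f_f)
  qed (use e Y.commute Y.triangle in \<open>auto simp: inv_into_f_f\<close>)
  interpret P: Metric_space12 "mspace Y" "mdist Y" ?M ?d ..
  have "homeomorphic_map Y.mtopology Z.mtopology e"
    by (rule P.isometry_imp_homeomorphic_map) (use e in \<open>auto simp: inv_into_f_f\<close>)
  then have "homeomorphic_map (mtopology_of Y) (mtopology_of (metric (?M, ?d))) e"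
    by (simp add: mtopology_of_def)
  then show thesis using that homeomorphic_map_maps by blast
qed

text \<open>The tower over a system on \<open>'b\<close> lives on \<open>'b \<times> nat\<close>,
  whereas the hypothesis of the theorem speaks of systems on reals. This lemma bridges the
  two.\<close>

lemma disjoint_from_all_minimal_any_type:
  assumes "tds X T" "disjoint_from_all_minimal TYPE(real) X T"
  shows "disjoint_from_all_minimal TYPE('c) X T"
  unfolding disjoint_from_all_minimal_def
proof (intro allI impI)
  fix Y :: "'c metric" and S assume m: "minimal_system Y S"
  then have t: "tds Y S" by (simp add: minimal_system_def)
  then obtain Z :: "real metric" and e g
    where h: "homeomorphic_maps (mtopology_of Y) (mtopology_of Z) e g"
    using compact_metric_lepoll_reals homeomorphic_copy_of_metric unfolding tds_def by metis
  then show "disjoint_systems X T Y S"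
    using minimal_system_conjugate[OF m h] disjoint_systems_conjugate[OF assms(1) t h] assms(2)
    by (simp add: disjoint_from_all_minimal_def)
qed

section \<open>Towers over a system and their minimality\<close>

definition tower :: "'b metric \<Rightarrow> nat \<Rightarrow> ('b \<times> nat) metric" where
  "tower Y n = prod_metric Y (metric ({..<n}, discrete_metric.dd))"

text \<open>For \<open>i < n\<close> the quotient \<open>Suc i div n\<close> is 1 on the top floor
  \<open>n - 1\<close> and 0 below it, so one formula covers both climbing and returning.\<close>

definition tower_map :: "('b \<Rightarrow> 'b) \<Rightarrow> nat \<Rightarrow> 'b \<times> nat \<Rightarrow> 'b \<times> nat" where
  "tower_map S n = (\<lambda>(y, i). ((S ^^ (Suc i div n)) y, Suc i mod n))"

lemma mspace_tower [simp]: "mspace (tower Y n) = mspace Y \<times> {..<n}"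
  by (simp add: tower_def Metric_space.mspace_metric[OF metric_M_dd])

lemma mtopology_of_tower:
  "mtopology_of (tower Y n) = prod_topology (mtopology_of Y) (discrete_topology {..<n})"
proof -
  interpret D: Metric_space "{..<n}" discrete_metric.dd
    by (rule metric_M_dd)
  interpret P: Metric_space12 "mspace Y" "mdist Y" "{..<n}" discrete_metric.dd
    by (simp add: Metric_space12_def D.Metric_space_axioms)
  show ?thesis
    using P.mtopology_prod_metric discrete_metric.mtopology_discrete_metric[of "{..<n}"]
    by (simp add: tower_def mtopology_of_def)
qed

text \<open>Continuity can be tested floor by floor: the slices over the points of \<open>I\<close>
  are open, and the preimage of an open set is the union of its slices.\<close>

lemma continuous_map_times_discrete:
  assumes "\<And>i. i \<in> I \<Longrightarrow> continuous_map X Z (\<lambda>y. f (y, i))"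
  shows "continuous_map (prod_topology X (discrete_topology I)) Z f"
  unfolding continuous_map
proof (intro conjI allI impI)
  show "f ` topspace (prod_topology X (discrete_topology I)) \<subseteq> topspace Z"
    using assms by (fastforce simp: continuous_map_def)
next
  fix U assume U: "openin Z U"
  have eq: "{p \<in> topspace (prod_topology X (discrete_topology I)). f p \<in> U}
      = (\<Union>i\<in>I. {y \<in> topspace X. f (y, i) \<in> U} \<times> {i})" by auto
  have "openin X {y \<in> topspace X. f (y, i) \<in> U}" if "i \<in> I" for i
    using assms[OF that] U by (auto simp: continuous_map_def)
  then show "openin (prod_topology X (discrete_topology I))
      {p \<in> topspace (prod_topology X (discrete_topology I)). f p \<in> U}"
    unfolding eq by (intro openin_Union) (auto simp: openin_prod_Times_iff)
qed

lemma tower_map_iterate: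
  assumes "i < n"
  shows "(tower_map S n ^^ k) (y, i) = ((S ^^ ((i + k) div n)) y, (i + k) mod n)"
proof (induction k)
  case (Suc k)
  \<comment> \<open>Division with remainder of \<open>i + k\<close> by \<open>n\<close>: one more
    step raises the remainder, and the carry \<open>Suc ((i + k) mod n) div n\<close> is the extra
    power of \<open>S\<close> in \<open>tower_map\<close>.\<close>
  have eq: "i + Suc k = Suc ((i + k) mod n) + n * ((i + k) div n)" by simp
  have "(i + Suc k) div n = Suc ((i + k) mod n) div n + (i + k) div n"
    "(i + Suc k) mod n = Suc ((i + k) mod n) mod n"
    unfolding eq using assms by (subst div_mult_self2; simp) (rule mod_mult_self2)
  then show ?case using Suc by (simp add: tower_map_def funpow_add)
qed (use assms in auto)

lemma tds_tower:
  assumes t: "tds Y S" and "n \<ge> 1"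
  shows "tds (tower Y n) (tower_map S n)"
proof -
  have "compact_space (mtopology_of (tower Y n))"
    using t by (simp add: mtopology_of_tower compact_space_prod_topology tds_def compact_space_discrete_topology)
  moreover have "continuous_map (mtopology_of (tower Y n)) (mtopology_of (tower Y n)) (tower_map S n)"
    unfolding mtopology_of_tower
    by (rule continuous_map_times_discrete)
      (use assms in \<open>auto simp: tower_map_def intro!: continuous_map_pairedI tds_iterate_continuous\<close>)
  moreover have "tower_map S n ` mspace (tower Y n) = mspace (tower Y n)"
  proof
    show "tower_map S n ` mspace (tower Y n) \<subseteq> mspace (tower Y n)"
      using assms tds_iterate_in[OF t] by (auto simp: tower_map_def)
    show "mspace (tower Y n) \<subseteq> tower_map S n ` mspace (tower Y n)"
    proof clarsimp
      fix y i assume y: "y \<in> mspace Y" and i: "i < n"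
      show "(y, i) \<in> tower_map S n ` (mspace Y \<times> {..<n})"
      proof (cases i)
        case 0
        \<comment> \<open>A ground-floor point is reached from the top floor above a preimage of
          \<open>y\<close>; this is where surjectivity of \<open>S\<close> enters.\<close>
        obtain z where "z \<in> mspace Y" "y = S z" using y t by (auto simp: tds_def)
        then show ?thesis using 0 i by (intro image_eqI[of _ _ "(z, n - 1)"]) (auto simp: tower_map_def)
      next
        case (Suc j)
        then show ?thesis using y i by (intro image_eqI[of _ _ "(y, j)"]) (auto simp: tower_map_def)
      qed
    qed
  qed
  ultimately show ?thesis
    using assms by (auto simp: tds_def lessThan_empty_iff)
qed

text \<open>From floor \<open>i\<close>, the orbit meets floor \<open>j\<close> at the times
  congruent to \<open>j - i\<close> modulo \<open>n\<close>, and the base points seen there run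
  through the \<open>S\<close>-orbit of the start, apart from at most its first point. Density on
  each floor thus follows from minimality of \<open>S\<close>.\<close>

lemma minimal_system_tower:
  assumes m: "minimal_system Y S" and n: "n \<ge> 1"
  shows "minimal_system (tower Y n) (tower_map S n)"
proof -
  have t: "tds Y S" using m by (simp add: minimal_system_def)
  have "p \<in> mtopology_of (tower Y n) closure_of range (\<lambda>k. (tower_map S n ^^ k) q)"
    if pq: "p \<in> mspace (tower Y n)" "q \<in> mspace (tower Y n)" for p q
    unfolding in_closure_of
  proof (intro conjI allI impI)
    show "p \<in> topspace (mtopology_of (tower Y n))" using pq by simp
    fix W assume W: "p \<in> W \<and> openin (mtopology_of (tower Y n)) W"
    obtain y i z j where p: "p = (z, j)" and q: "q = (y, i)" by fastforce
    have yz: "y \<in> mspace Y" "z \<in> mspace Y" "i < n" "j < n" using pq p q by auto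
    obtain U V where UV: "openin (mtopology_of Y) U" "z \<in> U" "j \<in> V" "U \<times> V \<subseteq> W"
      using W unfolding mtopology_of_tower openin_prod_topology_alt p by blast
    \<comment> \<open>Starting the orbit at \<open>S y\<close> gives a positive return time, so that no negative power of the tower map is needed.\<close>
    have "z \<in> mtopology_of Y closure_of range (\<lambda>k. (S ^^ k) (S y))"
      using m yz t by (auto simp: minimal_system_def tds_def)
    then obtain k where k: "(S ^^ k) (S y) \<in> U"
      using UV unfolding in_closure_of by blast
    have "i + (n * Suc k + j - i) = n * Suc k + j" using yz by simp
    then have "(tower_map S n ^^ (n * Suc k + j - i)) q = ((S ^^ Suc k) y, j)"
      unfolding q tower_map_iterate[OF yz(3)] using yz n by (simp del: mult_Suc_right funpow.simps)
    moreover have "((S ^^ Suc k) y, j) \<in> W" using k UV by (auto simp: funpow_Suc_right simp del: funpow.simps)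
    ultimately show "\<exists>x. x \<in> range (\<lambda>k. (tower_map S n ^^ k) q) \<and> x \<in> W" by (metis rangeI)
  qed
  then show ?thesis
    using tds_tower[OF t n] closure_of_subset_topspace[of "mtopology_of (tower Y n)"]
    unfolding minimal_system_def by fastforce
qed

text \<open>One step takes the copy of \<open>J\<close> on floor \<open>i\<close> to the copy on
  floor \<open>i + 1\<close>. From the top floor it arrives at \<open>(T ^^ n) x\<close> over
  \<open>S y\<close>, so invariance of \<open>J\<close> under \<open>T ^^ n\<close> and
  \<open>S\<close> closes the cycle.\<close>

lemma joining_tower:
  assumes X: "tds X T" and Y: "tds Y S" and n: "n \<ge> 1" and J: "joining X (T ^^ n) Y S J"
  shows "joining X T (tower Y n) (tower_map S n) (\<Union>i<n. (\<lambda>(x, y). ((T ^^ i) x, (y, i))) ` J)"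
    (is "joining _ _ _ _ ?J'")
proof -
  let ?P = "prod_topology (mtopology_of X) (mtopology_of Y)"
  let ?Q = "prod_topology (mtopology_of X) (mtopology_of (tower Y n))"
  have "compactin ?P J"
    using J X Y by (intro closedin_compact_space) (auto simp: joining_def tds_def compact_space_prod_topology)
  moreover have "continuous_map ?P ?Q (\<lambda>(x, y). ((T ^^ i) x, (y, i)))" if "i < n" for i
    unfolding mtopology_of_tower split_def
    using that tds_iterate_continuous[OF X]
    by (intro continuous_map_pairedI continuous_map_fst continuous_map_snd)
      (auto intro: continuous_map_compose[unfolded o_def] continuous_map_fst)
  ultimately have "compactin ?Q ?J'"
    by (intro compactin_Union) (auto intro: image_compactin)
  moreover have "Hausdorff_space ?Q"
    by (simp add: Hausdorff_space_prod_topology mtopology_of_def Metric_space.Hausdorff_space_mtopology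
        del: mspace_tower)
  ultimately have "closedin ?Q ?J'" by (rule compactin_imp_closedin[rotated])
  moreover have "map_prod T (tower_map S n) ` ?J' \<subseteq> ?J'"
  proof clarsimp
    fix x y i assume xy: "(x, y) \<in> J" and i: "i < n"
    show "\<exists>j\<in>{..<n}. (T ((T ^^ i) x), tower_map S n (y, i)) \<in> (\<lambda>(x, y). ((T ^^ j) x, y, j)) ` J"
    proof (cases "Suc i = n")
      case True
      have "((T ^^ n) x, S y) \<in> J" using J xy by (force simp: joining_def)
      then show ?thesis
        using True n by (intro bexI[of _ 0]) (force simp: tower_map_def)+
    next
      case False
      then show ?thesis
        using xy i by (intro bexI[of _ "Suc i"]) (force simp: tower_map_def)+
    qed
  qed
  moreover have "fst ` ?J' = mspace X"
  proof -
    have "fst ` ?J' = (\<Union>i<n. (T ^^ i) ` fst ` J)" by (force simp: image_UN)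
    then show ?thesis using J n tds_iterate_image[OF X] by (auto simp: joining_def lessThan_empty_iff)
  qed
  moreover have "snd ` ?J' = mspace (tower Y n)"
  proof -
    have "snd ` ?J' = snd ` J \<times> {..<n}" by force
    then show ?thesis using J by (simp add: joining_def)
  qed
  moreover have "?J' \<noteq> {}"
  proof -
    have "0 \<in> {..<n}" using n by simp
    then show ?thesis using J unfolding joining_def by blast
  qed
  ultimately show ?thesis unfolding joining_def by blast
qed

theorem theorem4p9:
  fixes X :: "'a metric" and T :: "'a \<Rightarrow> 'a" and n :: nat
  assumes "transitive_system X T"
    and "disjoint_from_all_minimal TYPE(real) X T"
    and "n \<ge> 1"
  shows "disjoint_from_all_minimal TYPE('b) X (T ^^ n)"
  unfolding disjoint_from_all_minimal_def
proof (intro allI impI)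
  fix Y :: "'b metric" and S assume m: "minimal_system Y S"
  have X: "tds X T" using assms(1) by (simp add: transitive_system_def)
  have Y: "tds Y S" using m by (simp add: minimal_system_def)
  have d: "disjoint_systems X T (tower Y n) (tower_map S n)"
    using disjoint_from_all_minimal_any_type[OF X assms(2)] minimal_system_tower[OF m assms(3)]
    by (auto simp: disjoint_from_all_minimal_def)
  show "disjoint_systems X (T ^^ n) Y S"
    unfolding disjoint_systems_iff[OF tds_iterate[OF X] Y]
  proof (intro allI impI)
    fix J assume J: "joining X (T ^^ n) Y S J"
    have eq: "(\<Union>i<n. (\<lambda>(x, y). ((T ^^ i) x, (y, i))) ` J) = mspace X \<times> mspace (tower Y n)"
      by (rule disjoint_systemsD[OF d joining_tower[OF X Y assms(3) J]])
    have "(x, y) \<in> J" if "x \<in> mspace X" "y \<in> mspace Y" for x y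
    proof -
      have "(x, (y, 0)) \<in> (\<Union>i<n. (\<lambda>(x, y). ((T ^^ i) x, (y, i))) ` J)"
        unfolding eq using that assms(3) by simp
      \<comment> \<open>The floor coordinate separates the copies of \<open>J\<close>, so the point
        comes from the copy with \<open>i = 0\<close>, where \<open>T ^^ 0\<close> is the
        identity.\<close>
      then show ?thesis by auto
    qed
    then show "J = mspace X \<times> mspace Y" using joining_subset[OF J] by auto
  qed
qed

end
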